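(* Let $M,L\ge 1$ and $1\le N'\le N$ be integers, and let $$1<R_0<R_1<R_2<\dots<R_M<\frac{N-N'}{2}$$ be natural numbers such that $R_m\ge 4R_{m-1}$ for all $m=1,\dots,M$, and $R_0\ge 100L\cdot 8^M$. Let $a_1,\dots,a_N$ be a sequence of non-negative integers, with resulting Gilbreath array $a_{(i,j)}$ for $0\le i\le N-1$ and $1\le j\le N-i$. Assume: (i) $a_n\le 2^M$ for all $n=1,\dots,N$. (ii) There do not exist integers $0\le i\le N-L$ and $1\le j\le N-i-L+1$ such that $a_{(i,j)}=a_{(i,j+1)}=\dots=a_{(i,j+L-1)}=0$. (iii) There do not exist integers $1\le m\le M$, $2^{M-m}<d\le 2^{M-m+1}$, $0\le i\le 2R_{m-1}$, $k\ge R_m-3R_{m-1}$, and $N'\le j\le N-i-k$, such that $a_{(i,j)},a_{(i,j+1)},\dots,a_{(i,j+k-1)}\in\{0,d\}$. Then $a_{(N-1,1)}\in\{0,1\}$.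
   Context: The Gilbreath array generated by a finite sequence $a_1,\dots,a_N$ is the triangular array $a_{(i,j)}$, $0\le i\le N-1$, $1\le j\le N-i$, defined by $a_{(0,j)}=a_j$ and $a_{(i+1,j)}=|a_{(i,j)}-a_{(i,j+1)}|$. *)

theory Defs
  imports Complex_Main
begin

text \<open>
  The sequence is indexed from 1, so \<open>a 0\<close> is never used. The recursion is total, but for
  \<open>1 \<le> j\<close> and \<open>i + j \<le> N\<close> the entry \<open>gilbreath a i j\<close> depends only on \<open>a 1, \<dots>, a N\<close>: these
  are exactly the positions of the triangular array generated by \<open>a 1, \<dots>, a N\<close>.
\<close>

fun gilbreath :: "(nat \<Rightarrow> int) \<Rightarrow> nat \<Rightarrow> nat \<Rightarrow> int" where
  "gilbreath a 0 j = a j"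
| "gilbreath a (Suc i) j = \<bar>gilbreath a i j - gilbreath a i (j + 1)\<bar>"

end

theory Submission
  imports Defs
begin

text \<open>
  The array rewards a value that equals the current maximum \<open>c\<close> with rigidity. A difference of two
  numbers in \<open>[0, c]\<close> equals \<open>c\<close> only if they are \<open>0\<close> and \<open>c\<close>, and next to an entry in \<open>{0, c}\<close> a
  difference in \<open>{0, c}\<close> forces the other entry into \<open>{0, c}\<close>. Hence a value \<open>c\<close> in a region where
  nothing exceeds \<open>c\<close> forces everything above it in this region to be \<open>{0, c}\<close>-valued
  (\<open>two_valued_above\<close>). The hypothesis on blocks of \<open>L\<close> zeros keeps the value \<open>c\<close> present while the
  argument moves upwards along the border of the region.

  Let \<open>2 * B\<close> be an upper bound on the entries. The main step shows that \<open>B\<close> becomes an upper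
  bound further down. For this it produces in every long window a \<^emph>\<open>gap\<close>, that is, \<open>2 * B * L\<close>
  consecutive entries of a row that are at most \<open>B\<close>. If a value \<open>c > B\<close> is the maximum of the
  window and still occurs \<open>t\<close> rows later, then the row of the window contains a \<open>{0, c}\<close>-valued block
  of length \<open>t\<close>. This block cannot fill the window, so some entry \<open>e\<close> strictly between \<open>0\<close> and \<open>c\<close>
  borders on it. The border line through \<open>e\<close> reads \<open>0\<close> and \<open>c\<close> from the block and therefore
  carries only the values \<open>e\<close> and \<open>c - e\<close>, both recurring. Such a line is incompatible with every value
  \<open>c' > B\<close> being the maximum behind it, and \<open>c, c - 1, \<dots>, B + 1\<close> disappear there one after the
  other (\<open>gap_right_of_block\<close>). If instead \<open>c\<close> does not survive, the maximum has dropped, which can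
  happen only \<open>B\<close> times (\<open>gap_exists\<close>).

  By the rigidity, a gap also clears everything whose cone of ancestors contains it: a value above
  \<open>B\<close> below the gap would make the gap two-valued, hence zero (\<open>gap_spreads\<close>). Since this cleans
  columns arbitrarily far to the left of the gap, it does no harm that \<open>{0, d}\<close>-valued blocks are excluded only
  to the right of the column \<open>N'\<close>. After \<open>M\<close> halvings the bound is \<open>1\<close>.
\<close>

section \<open>Arrays of absolute differences without long zero blocks\<close>

text \<open>
  Columns are integers and the rule holds everywhere, so that reversing all rows gives an array of the
  same kind. The triangle \<open>A \<le> j\<close>, \<open>i + j \<le> Z\<close> is bounded by the column \<open>A\<close> and the diagonal
  \<open>i + j = Z\<close>; it contains all ancestors of its entries. The word diagonal always refers to the lines
  on which \<open>i + j\<close> is constant.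
\<close>

locale zero_sparse_triangle =
  fixes g :: "nat \<Rightarrow> int \<Rightarrow> int" and A Z L :: int
  assumes step: "g (Suc i) j = \<bar>g i j - g i (j + 1)\<bar>"
    and nonneg: "A \<le> j \<Longrightarrow> int i + j \<le> Z \<Longrightarrow> 0 \<le> g i j"
    and nonzero: "A \<le> j \<Longrightarrow> int i + j + L - 1 \<le> Z \<Longrightarrow> \<exists>q\<in>{j..j + L - 1}. g i q \<noteq> 0"
    and L_pos: "1 \<le> L"
begin

text \<open>
  Reversing the rows exchanges columns and diagonals, the two kinds of lines along which a block
  of a row shrinks on its way down.
\<close>

lemma mirror: "zero_sparse_triangle (\<lambda>i j. g i (A + Z - int i - j)) A Z L"
proof
  fix i j
  have "A + Z - int (Suc i) - j + 1 = A + Z - int i - j"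
    "A + Z - int (Suc i) - j = A + Z - int i - (j + 1)" by auto
  then show "g (Suc i) (A + Z - int (Suc i) - j)
      = \<bar>g i (A + Z - int i - j) - g i (A + Z - int i - (j + 1))\<bar>"
    by (simp only: step)
next
  fix i j assume "A \<le> j" "int i + j \<le> Z"
  then show "0 \<le> g i (A + Z - int i - j)" by (intro nonneg) auto
next
  fix i j assume "A \<le> j" "int i + j + L - 1 \<le> Z"
  then obtain q where "q \<in> {A + Z - int i - j - L + 1..A + Z - int i - j - L + 1 + L - 1}"
    "g i q \<noteq> 0"
    using nonzero[of "A + Z - int i - j - L + 1" i] by auto
  then show "\<exists>q\<in>{j..j + L - 1}. g i (A + Z - int i - q) \<noteq> 0"
    by (intro bexI[of _ "A + Z - int i - q"]) auto
qed (rule L_pos)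

lemma cone_bound:
  assumes "\<And>q. p \<le> q \<Longrightarrow> q \<le> r \<Longrightarrow> g i0 q \<le> c" "A \<le> p" "int i0 + r \<le> Z"
    and "i0 \<le> i" "p \<le> j" "int i + j \<le> int i0 + r"
  shows "g i j \<le> c"
  using assms(4-6)
proof (induction i arbitrary: j rule: dec_induct)
  case base
  then show ?case using assms(1) by simp
next
  case (step i)
  have "g i j \<le> c" "g i (j + 1) \<le> c" using step.IH step.prems by simp_all
  moreover have "0 \<le> g i j" "0 \<le> g i (j + 1)"
    using step.prems assms(2,3) by (auto intro!: nonneg)
  ultimately show ?case unfolding zero_sparse_triangle.step[OF zero_sparse_triangle_axioms] by linarith
qed

lemma cone_two_valued:
  assumes "\<And>q. p \<le> q \<Longrightarrow> q \<le> r \<Longrightarrow> g i0 q \<in> {0, c}" "0 \<le> c"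
    and "i0 \<le> i" "p \<le> j" "int i + j \<le> int i0 + r"
  shows "g i j \<in> {0, c}"
  using assms(3-5)
proof (induction i arbitrary: j rule: dec_induct)
  case base
  then show ?case using assms(1) by simp
next
  case (step i)
  have "g i j \<in> {0, c}" "g i (j + 1) \<in> {0, c}" using step.IH[of j] step.IH[of "j + 1"] step.prems by auto
  then show ?case unfolding zero_sparse_triangle.step[OF zero_sparse_triangle_axioms]
    using assms(2) by auto
qed

section \<open>Rigidity of the maximal value\<close>

text \<open>
  The difference \<open>c\<close> at \<open>q0\<close> puts both of its parents into \<open>{0, c}\<close>. From there the property moves
  to the right and to the left, because an entry of \<open>{0, c}\<close> and a difference in \<open>{0, c}\<close> leave only
  \<open>0\<close> and \<open>c\<close> for the neighbour in \<open>[0, c]\<close>.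
\<close>

lemma two_valued_parents:
  assumes two: "\<And>q. l \<le> q \<Longrightarrow> q \<le> r \<Longrightarrow> g (Suc i) q \<in> {0, c}"
    and q0: "l \<le> q0" "q0 \<le> r" "g (Suc i) q0 = c"
    and bound: "\<And>q. l \<le> q \<Longrightarrow> q \<le> r + 1 \<Longrightarrow> 0 \<le> g i q \<and> g i q \<le> c"
  shows "(\<forall>q. l \<le> q \<and> q \<le> r + 1 \<longrightarrow> g i q \<in> {0, c})
    \<and> (\<exists>q. l \<le> q \<and> q \<le> r + 1 \<and> g i q = c)"
proof -
  have par: "g i q0 = 0 \<and> g i (q0 + 1) = c \<or> g i q0 = c \<and> g i (q0 + 1) = 0"
    using q0 bound[of q0] bound[of "q0 + 1"] step[of i q0] by auto
  have right: "q \<le> r + 1 \<Longrightarrow> g i q \<in> {0, c}" if "q0 \<le> q" for q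
    using that
  proof (induction q rule: int_ge_induct)
    case base
    then show ?case using par by auto
  next
    case (step q)
    have "g i q \<in> {0, c}" "g (Suc i) q \<in> {0, c}" using step two[of q] q0 by auto
    then show ?case
      using zero_sparse_triangle.step[OF zero_sparse_triangle_axioms, of i q]
        bound[of "q + 1"] step q0 by auto
  qed
  have left: "l \<le> q \<Longrightarrow> g i q \<in> {0, c}" if "q \<le> q0" for q
    using that
  proof (induction q rule: int_le_induct)
    case base
    then show ?case using par by auto
  next
    case (step q)
    have "g i q \<in> {0, c}" "g (Suc i) (q - 1) \<in> {0, c}" using step two[of "q - 1"] q0 by auto
    then show ?case
      using zero_sparse_triangle.step[OF zero_sparse_triangle_axioms, of i "q - 1"]
        bound[of "q - 1"] step q0 by auto
  qed
  have "g i q \<in> {0, c}" if "l \<le> q" "q \<le> r + 1" for q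
    using left[of q] right[of q] that by linarith
  moreover have "\<exists>q. l \<le> q \<and> q \<le> r + 1 \<and> g i q = c"
  proof (cases "g i q0 = c")
    case True
    then show ?thesis using q0 by (intro exI[of _ q0]) auto
  next
    case False
    then show ?thesis using q0 par by (intro exI[of _ "q0 + 1"]) auto
  qed
  ultimately show ?thesis by blast
qed

text \<open>
  The bound \<open>c\<close> is required only right of the diagonal \<open>lo\<close> and left of the column \<open>hi\<close>; only there
  are the ancestors of the entry \<open>(i, j)\<close> identified. Going up one row, at these two borders the
  entries with only one parent in the region have to be given up, and with them perhaps all
  occurrences of \<open>c\<close>. But once a border is met the block has at least \<open>L\<close> entries
  left, and not all of them are zero.
\<close>

lemma two_valued_above:
  assumes ij: "g i j = c" "A \<le> j" "int i + j \<le> Z"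
    and bound: "\<And>k q. i0 \<le> k \<Longrightarrow> k < i \<Longrightarrow> j \<le> q \<Longrightarrow> int k + q \<le> int i + j \<Longrightarrow>
      lo \<le> int k + q \<Longrightarrow> q \<le> hi \<Longrightarrow> g k q \<le> c"
    and room: "lo + L \<le> int i + j" "j + L \<le> hi" "lo + L \<le> int i0 + hi"
    and k: "i0 \<le> k" "k \<le> i"
  shows "(\<forall>q. max j (lo - int k) \<le> q \<and> q \<le> min (int i + j - int k) hi \<longrightarrow> g k q \<in> {0, c})
    \<and> (\<exists>q. max j (lo - int k) \<le> q \<and> q \<le> min (int i + j - int k) hi \<and> g k q = c)"
  using k(2) k(1)
proof (induction k rule: inc_induct)
  case base
  then show ?case using ij room L_pos by auto
next
  case (step k)
  \<comment> \<open>The columns \<open>l..r\<close> of row \<open>Suc k\<close> are those with both parents in the region.\<close>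
  define l r where "l = max j (lo - int k)" and "r = min (int i + j - int k) hi - 1"
  have sub: "max j (lo - int (Suc k)) \<le> l" "r \<le> min (int i + j - int (Suc k)) hi"
    unfolding l_def r_def by auto
  have IH: "\<And>q. max j (lo - int (Suc k)) \<le> q \<Longrightarrow> q \<le> min (int i + j - int (Suc k)) hi \<Longrightarrow>
      g (Suc k) q \<in> {0, c}"
    and ex: "\<exists>q. max j (lo - int (Suc k)) \<le> q \<and> q \<le> min (int i + j - int (Suc k)) hi
      \<and> g (Suc k) q = c"
    using step.IH step.prems by auto
  have two: "g (Suc k) q \<in> {0, c}" if "l \<le> q" "q \<le> r" for q
    using IH[of q] that sub by linarith
  have "\<exists>q. l \<le> q \<and> q \<le> r \<and> g (Suc k) q = c"
  proof (cases "l = max j (lo - int (Suc k)) \<and> r = min (int i + j - int (Suc k)) hi")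
    case True
    then show ?thesis using ex by simp
  next
    case False
    then have "l + L \<le> r + 1"
      using room step.prems step.hyps unfolding l_def r_def by (auto simp: min_def max_def split: if_splits)
    moreover have "A \<le> l" "int (Suc k) + r \<le> Z"
      using ij unfolding l_def r_def by (auto simp: min_def)
    ultimately obtain q where "q \<in> {l..l + L - 1}" "g (Suc k) q \<noteq> 0"
      using nonzero[of l "Suc k"] by auto
    then show ?thesis using two[of q] \<open>l + L \<le> r + 1\<close> by (intro exI[of _ q]) auto
  qed
  then obtain q0 where q0: "l \<le> q0" "q0 \<le> r" "g (Suc k) q0 = c" by blast
  have "0 \<le> g k q \<and> g k q \<le> c" if "l \<le> q" "q \<le> r + 1" for q
    using that ij step.prems step.hyps unfolding l_def r_def
    by (intro conjI nonneg bound) auto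
  from two_valued_parents[OF two q0 this]
  show ?case unfolding l_def r_def by simp
qed

section \<open>Reading along diagonals\<close>

text \<open>
  Two consecutive zeros on a diagonal make the neighbour on the preceding diagonal zero as well,
  so zeros on a stretch of a diagonal fill the triangle above it, up to a zero block in its top row.
\<close>

lemma zero_diagonal:
  assumes "\<And>u. u < n \<Longrightarrow> g (i + u) (j - int u) = 0"
  shows "u + v < n \<Longrightarrow> g (i + u) (j - int u - int v) = 0"
proof (induction v arbitrary: u)
  case 0
  then show ?case using assms by simp
next
  case (Suc v)
  define x where "x = j - int u - int (Suc v)"
  have x: "j - int (Suc u) - int v = x" "j - int u - int v = x + 1" unfolding x_def by auto
  have "g (Suc (i + u)) x = 0" "g (i + u) (x + 1) = 0"
    using Suc.IH[of "Suc u"] Suc.IH[of u] Suc.prems unfolding x by auto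
  then show ?case using step[of "i + u" x] unfolding x_def[symmetric] by simp
qed

lemma nonzero_diagonal:
  assumes "A \<le> j - L + 1" "int i + j \<le> Z"
  shows "\<exists>u. int u < L \<and> g (i + u) (j - int u) \<noteq> 0"
proof (rule ccontr)
  assume "\<not> ?thesis"
  then have z: "g (i + u) (j - int u) = 0" if "u < nat L" for u using that by auto
  obtain q where q: "q \<in> {j - L + 1..j - L + 1 + L - 1}" "g i q \<noteq> 0"
    using nonzero[of "j - L + 1" i] assms by auto
  then have "g (i + 0) (j - int 0 - int (nat (j - q))) = 0"
    by (intro zero_diagonal[OF z]) auto
  then show False using q by simp
qed

text \<open>
  If \<open>v\<close> and \<open>v'\<close> follow each other on a diagonal, the entry \<open>b\<close> between them on the preceding
  diagonal satisfies \<open>\<bar>b - v\<bar> = v'\<close>, hence \<open>b = v + v'\<close> or \<open>b = v - v'\<close>. For \<open>v, v' \<in> {0, c}\<close> this leaves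
  \<open>b \<in> {0, c}\<close> as soon as \<open>0 \<le> b < 2 * c\<close>. In contrast to \<open>two_valued_above\<close>, values larger
  than \<open>c\<close> are harmless here.
\<close>

lemma two_valued_previous_diagonals:
  assumes two: "\<And>i. i1 \<le> i \<Longrightarrow> i \<le> i2 \<Longrightarrow> g i (n - int i) \<in> {0, c}"
    and bound: "\<And>i m. i1 \<le> i \<Longrightarrow> i \<le> i2 \<Longrightarrow> n - int k \<le> m \<Longrightarrow> m \<le> n \<Longrightarrow>
      0 \<le> g i (m - int i) \<and> g i (m - int i) < 2 * c"
  shows "i1 \<le> i \<Longrightarrow> i + k \<le> i2 \<Longrightarrow> g i (n - int k - int i) \<in> {0, c}"
  using bound
proof (induction k arbitrary: i)
  case 0
  then show ?case using two by simp
next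
  case (Suc k)
  define x where "x = n - int (Suc k) - int i"
  have x: "n - int k - int (Suc i) = x" "n - int k - int i = x + 1" unfolding x_def by auto
  have "g i (x + 1) \<in> {0, c}" "g (Suc i) x \<in> {0, c}"
    using Suc.IH[of i] Suc.IH[of "Suc i"] Suc.prems unfolding x by auto
  moreover have "0 \<le> g i x" "g i x < 2 * c"
    using Suc.prems(3)[of i "n - int (Suc k)"] Suc.prems(1,2) unfolding x_def by auto
  ultimately show ?case using step[of i x] unfolding x_def[symmetric] by auto
qed

text \<open>
  The diagonal that passes just right of a \<open>{0, c}\<close>-valued block reads only \<open>0\<close> and \<open>c\<close> while it runs
  below the block; reading \<open>0\<close> keeps its value and reading \<open>c\<close> replaces \<open>e\<close> by \<open>c - e\<close> and back.
\<close>

lemma diagonal_beside_block: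
  assumes two: "\<And>q. y - t \<le> q \<Longrightarrow> q \<le> y \<Longrightarrow> g i0 q \<in> {0, c}"
    and e: "0 < g i0 (y + 1)" "g i0 (y + 1) < c"
  shows "int u \<le> t \<Longrightarrow> g (i0 + u) (y + 1 - int u) \<in> {g i0 (y + 1), c - g i0 (y + 1)}"
proof (induction u)
  case 0
  then show ?case by simp
next
  case (Suc u)
  define x where "x = y + 1 - int (Suc u)"
  have x: "y + 1 - int u = x + 1" unfolding x_def by simp
  have "g (i0 + u) x \<in> {0, c}"
    using Suc.prems e unfolding x_def
    by (intro cone_two_valued[OF two, where r = y]) auto
  moreover have "g (i0 + u) (x + 1) \<in> {g i0 (y + 1), c - g i0 (y + 1)}"
    using Suc unfolding x by auto
  ultimately show ?case using step[of "i0 + u" x] e unfolding x_def[symmetric] by auto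
qed

section \<open>Creation of gaps\<close>

text \<open>
  Let \<open>n0\<close> be the diagonal of the entry \<open>e\<close> in column \<open>y + 1\<close>, and let \<open>v = L + 1 + w\<close>. The values
  \<open>c, c - 1, \<dots>\<close> disappear from the diagonals \<open>n0 + h * L, \<dots>, n0 + w\<close> one by one, each at
  the cost of \<open>v\<close> rows and \<open>L\<close> diagonals. Suppose that \<open>c'\<close> bounds the entries on these diagonals
  and still occurs \<open>v\<close> rows later. Then the diagonal \<open>n0 + h * L\<close> is \<open>{0, c'}\<close>-valued above it, and
  so is \<open>n0\<close>, by reading backwards, for \<open>L + 1\<close> consecutive rows. But the diagonal \<open>n0\<close> has only the
  values \<open>e\<close> and \<open>c - e\<close>, which are not \<open>0\<close>, so it would be constantly \<open>c'\<close>. As \<open>2 * c' > c\<close>, it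
  would have to read \<open>L\<close> zeros in succession from the block.
\<close>

lemma gap_right_of_block:
  fixes B G t :: int
  defines "w \<equiv> B * L + G"
  assumes c: "B < c" "c \<le> 2 * B"
    and G: "0 \<le> G"
    and t: "B * (L + 1 + w) \<le> t"
    and two: "\<And>q. x \<le> q \<Longrightarrow> q \<le> y \<Longrightarrow> g i0 q \<in> {0, c}" and xy: "x + t \<le> y"
    and e: "g i0 (y + 1) \<notin> {0, c}"
    and bound: "\<And>q. x \<le> q \<Longrightarrow> q \<le> y + 1 + w \<Longrightarrow> g i0 q \<le> c"
    and inside: "A \<le> x" "int i0 + y + 1 + w \<le> Z"
  shows "\<exists>k l. i0 \<le> k \<and> int k \<le> int i0 + t \<and> x \<le> l \<and> int k + l + G - 1 \<le> int i0 + y + 1 + w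
    \<and> (\<forall>q. l \<le> q \<and> q \<le> l + G - 1 \<longrightarrow> g k q \<le> B)"
proof -
  define n0 where "n0 = y + 1 + int i0"
  define v where "v = L + 1 + w"
  have B: "0 < B" using c by simp
  have w: "0 \<le> w" unfolding w_def using B G L_pos by simp
  have v: "L + 1 \<le> v" "0 < v" unfolding v_def using w L_pos by auto
  have vt: "B * v \<le> t" using t unfolding v_def .
  have hv: "int h * v \<le> t" "int h * L \<le> B * L" if "int h \<le> B" for h
    using mult_right_mono[OF that, of v] mult_right_mono[OF that, of L] v vt L_pos by linarith+
  have t0: "0 \<le> t" using hv[of 0] B by simp
  have e': "0 < g i0 (y + 1)" "g i0 (y + 1) < c"
    using e bound[of "y + 1"] nonneg[of "y + 1" i0] inside xy t0 w by auto
  have low: "g k q \<le> c" "0 \<le> g k q"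
    if "i0 \<le> k" "int k \<le> int i0 + t" "n0 \<le> int k + q" "int k + q \<le> n0 + w" for k q
  proof -
    have "x \<le> q" using that xy unfolding n0_def by simp
    then show "g k q \<le> c" "0 \<le> g k q"
      using that inside unfolding n0_def
      by (auto intro!: nonneg cone_bound[OF bound, where i = k])
  qed
  have main: "g i (n0 + s - int i) \<le> c - int h"
    if "int h \<le> c - B" "int i0 + int h * v \<le> int i" "int i \<le> int i0 + t"
      "int h * L \<le> s" "s \<le> w" for h i s
    using that
  proof (induction h arbitrary: i s)
    case 0
    then show ?case using low[of i "n0 + s - int i"] by simp
  next
    case (Suc h)
    define c' where "c' = c - int h"
    define j where "j = n0 + s - int i"
    define i1 where "i1 = nat (int i0 + int h * v)"
    have hB: "int (Suc h) \<le> B" using Suc.prems c by simp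
    have i1: "int i1 = int i0 + int h * v" unfolding i1_def using v by simp
    have hvS: "int (Suc h) * v = int h * v + v" "int (Suc h) * L = int h * L + L"
      by (auto simp: algebra_simps)
    have hL: "0 \<le> int h * L" "0 \<le> int h * v" using L_pos v by auto
    have late: "int i1 + L + 1 + w \<le> int i"
      using Suc.prems(2) hvS(1) i1 v_def by linarith
    have i01: "i0 \<le> i1" using i1 hL(2) by linarith
    have c': "B < c'" "c < 2 * c'" using Suc.prems c unfolding c'_def by auto
    have le: "g i j \<le> c'"
      unfolding j_def c'_def using Suc.prems hvS v L_pos by (intro Suc.IH) auto
    have "g i j \<noteq> c'"
    proof
      assume eq: "g i j = c'"
      have jA: "A \<le> j" "int i + j \<le> Z"
        using inside Suc.prems xy hL hvS L_pos unfolding j_def n0_def by linarith+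
      have reg: "g k q \<le> c'"
        if "i1 \<le> k" "k < i" "j \<le> q" "int k + q \<le> int i + j" "n0 + int h * L \<le> int k + q" for k q
      proof -
        have "g k (n0 + (int k + q - n0) - int k) \<le> c - int h"
          using that Suc.prems i1 hvS unfolding j_def by (intro Suc.IH) auto
        then show ?thesis unfolding c'_def by simp
      qed
      \<comment> \<open>On the left border diagonal of the region; \<open>s - h * L\<close> is its distance from \<open>(i, j)\<close>.\<close>
      have up: "g k (n0 + int h * L - int k) \<in> {0, c'}"
        if k: "i1 \<le> k" "int k \<le> int i - (s - int h * L)" for k
      proof -
        have "i1 \<le> k" "k \<le> i" using k hvS Suc.prems L_pos by auto
        from two_valued_above[OF eq jA reg _ _ _ this, of "n0 + int h * L" "int i + j - int i1"]
        have "max j (n0 + int h * L - int k) \<le> q \<and>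
            q \<le> min (int i + j - int k) (int i + j - int i1) \<longrightarrow> g k q \<in> {0, c'}" for q
          using i1 hvS v Suc.prems unfolding j_def by auto
        then show ?thesis
          using k hvS Suc.prems L_pos i1 unfolding j_def by auto
      qed
      have diag: "g k (n0 - int k) \<in> {0, c'}" if k: "i1 \<le> k" "int k \<le> int i1 + L" for k
      proof -
        have nn: "0 \<le> int i - (s - int h * L)"
          using late Suc.prems(5) hL(1) L_pos by linarith
        have up': "g k (n0 + int h * L - int k) \<in> {0, c'}"
          if "i1 \<le> k" "k \<le> nat (int i - (s - int h * L))" for k
          using that up[of k] nn by (simp add: le_nat_iff)
        have "g k (n0 + int h * L - int (nat (int h * L)) - int k) \<in> {0, c'}"
        proof (rule two_valued_previous_diagonals[OF up'])
          fix k m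
          assume a: "i1 \<le> k" "k \<le> nat (int i - (s - int h * L))"
            "n0 + int h * L - int (nat (int h * L)) \<le> m" "m \<le> n0 + int h * L"
          have "n0 \<le> m" using a hL by simp
          moreover have "m \<le> n0 + w" "int h * L \<le> s"
            using a(4) Suc.prems(4,5) hvS L_pos by linarith+
          moreover have "i0 \<le> k" "int k \<le> int i0 + t"
            using a(1,2) i1 hL nn Suc.prems(3) \<open>int h * L \<le> s\<close> by linarith+
          ultimately show "0 \<le> g k (m - int k) \<and> g k (m - int k) < 2 * c'"
            using low[of k "m - int k"] c' by simp
        next
          show "k + nat (int h * L) \<le> nat (int i - (s - int h * L))"
            using k late Suc.prems(5) hL(1) nn by (simp add: le_nat_iff)
        qed (use k in auto)
        then show ?thesis using hL by simp
      qed
      have const: "g k (n0 - int k) = c'" if k: "i1 \<le> k" "int k \<le> int i1 + L" for k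
      proof -
        have kt: "int (k - i0) \<le> t" "i0 \<le> k"
          using k i01 late Suc.prems(3) w by auto
        have "g (i0 + (k - i0)) (y + 1 - int (k - i0)) \<in> {g i0 (y + 1), c - g i0 (y + 1)}"
          by (rule diagonal_beside_block[OF _ e' kt(1)]) (use two xy in auto)
        moreover have "y + 1 - int (k - i0) = n0 - int k" "i0 + (k - i0) = k"
          using kt unfolding n0_def by auto
        ultimately have "g k (n0 - int k) \<in> {g i0 (y + 1), c - g i0 (y + 1)}" by (simp only:)
        then show ?thesis using diag[OF k] e' by auto
      qed
      \<comment> \<open>The last diagonal through the block has a nonzero entry in one of these rows; keeping
        the value \<open>c'\<close> there would take the entry \<open>2 * c'\<close>.\<close>
      obtain u where u: "int u < L" "g (i1 + u) (n0 - 1 - int i1 - int u) \<noteq> 0"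
        using nonzero_diagonal[of "n0 - 1 - int i1" i1] inside xy i01 late Suc.prems(3) w
        unfolding n0_def by auto
      define z where "z = n0 - 1 - int i1 - int u"
      have z: "n0 - int (i1 + u) = z + 1" "n0 - int (Suc (i1 + u)) = z" unfolding z_def by auto
      have "g (i1 + u) (z + 1) = c'" "g (Suc (i1 + u)) z = c'"
        using const[of "i1 + u"] const[of "Suc (i1 + u)"] u(1) unfolding z by auto
      moreover have "g (i1 + u) z \<le> c"
      proof (rule cone_bound[OF bound])
        show "x \<le> z" "int (i1 + u) + z \<le> int i0 + (y + 1 + w)"
          using xy i01 late Suc.prems(3) w u(1) unfolding z_def n0_def by auto
      qed (use inside i01 in auto)
      ultimately show False
        using step[of "i1 + u" z] u(2) c' B unfolding z_def[symmetric] by auto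
    qed
    then show ?case using le unfolding c'_def j_def by simp
  qed
  define h where "h = nat (c - B)"
  have h: "int h = c - B" unfolding h_def using c by simp
  have hB: "int h * v \<le> t" "int h * L \<le> B * L" using hv[of h] h c by auto
  define k where "k = nat (int i0 + int h * v)"
  have k: "int k = int i0 + int h * v" unfolding k_def using v by simp
  have hv0: "0 \<le> int h * v" "0 \<le> int h * L" using v L_pos by auto
  define l where "l = n0 + int h * L - int k"
  have "g k q \<le> B" if "l \<le> q" "q \<le> l + G - 1" for q
  proof -
    have "int h * L + G \<le> w" using hB unfolding w_def by simp
    then have "g k (n0 + (q + int k - n0) - int k) \<le> c - int h"
      using that h k hB(1) unfolding l_def by (intro main) simp_all
    then show ?thesis using h by simp
  qed
  moreover have "i0 \<le> k" "int k \<le> int i0 + t" "x \<le> l" "int k + l + G - 1 \<le> int i0 + y + 1 + w"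
    using k hB hv0 xy unfolding l_def n0_def w_def by auto
  ultimately show ?thesis by blast
qed

lemma gap_left_of_block:
  fixes B G t :: int
  defines "w \<equiv> B * L + G"
  assumes c: "B < c" "c \<le> 2 * B"
    and G: "0 \<le> G"
    and t: "B * (L + 1 + w) \<le> t"
    and two: "\<And>q. x \<le> q \<Longrightarrow> q \<le> y \<Longrightarrow> g i0 q \<in> {0, c}" and xy: "x + t \<le> y"
    and e: "g i0 (x - 1) \<notin> {0, c}"
    and bound: "\<And>q. x - 1 - w \<le> q \<Longrightarrow> q \<le> y \<Longrightarrow> g i0 q \<le> c"
    and inside: "A \<le> x - 1 - w" "int i0 + y \<le> Z"
  shows "\<exists>k l. i0 \<le> k \<and> int k \<le> int i0 + t \<and> x - 1 - w \<le> l \<and> int k + l + G - 1 \<le> int i0 + y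
    \<and> (\<forall>q. l \<le> q \<and> q \<le> l + G - 1 \<longrightarrow> g k q \<le> B)"
proof -
  interpret m: zero_sparse_triangle "\<lambda>i j. g i (A + Z - int i - j)" A Z L by (rule mirror)
  define S where "S = A + Z - int i0"
  have "\<exists>k l. i0 \<le> k \<and> int k \<le> int i0 + t \<and> S - y \<le> l
      \<and> int k + l + G - 1 \<le> int i0 + (S - x) + 1 + (B * L + G)
      \<and> (\<forall>q. l \<le> q \<and> q \<le> l + G - 1 \<longrightarrow> g k (A + Z - int k - q) \<le> B)"
  proof (rule m.gap_right_of_block[OF c G])
    show "B * (L + 1 + (B * L + G)) \<le> t" using t unfolding w_def .
    show "g i0 (A + Z - int i0 - q) \<in> {0, c}" if "S - y \<le> q" "q \<le> S - x" for q
      using that unfolding S_def by (intro two) auto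
    show "g i0 (A + Z - int i0 - (S - x + 1)) \<notin> {0, c}"
      using e unfolding S_def by (simp add: algebra_simps)
    show "g i0 (A + Z - int i0 - q) \<le> c" if "S - y \<le> q" "q \<le> S - x + 1 + (B * L + G)" for q
      using that unfolding S_def w_def[symmetric] by (intro bound) auto
    show "S - y + t \<le> S - x" "A \<le> S - y" "int i0 + (S - x) + 1 + (B * L + G) \<le> Z"
      using xy inside unfolding S_def w_def[symmetric] by auto
  qed
  then obtain k l where kl: "i0 \<le> k" "int k \<le> int i0 + t" "S - y \<le> l"
      "int k + l + G - 1 \<le> int i0 + (S - x) + 1 + w"
      and gap: "\<And>q. l \<le> q \<Longrightarrow> q \<le> l + G - 1 \<Longrightarrow> g k (A + Z - int k - q) \<le> B"
    unfolding w_def by blast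
  define l' where "l' = A + Z - int k - l - G + 1"
  have "g k q \<le> B" if "l' \<le> q" "q \<le> l' + G - 1" for q
    using gap[of "A + Z - int k - q"] that unfolding l'_def by simp
  moreover have "x - 1 - w \<le> l'" "int k + l' + G - 1 \<le> int i0 + y"
    using kl unfolding l'_def S_def by auto
  ultimately show ?thesis using kl(1,2) by blast
qed

text \<open>
  The window consists of the columns from \<open>p\<close> and the diagonals up to \<open>n\<close>, and \<open>B + h\<close> bounds its
  entries. Either \<open>t\<close> rows later the bound has improved, or a value \<open>B + h\<close> has survived \<open>t\<close> rows and
  stands below a \<open>{0, B + h}\<close>-valued block of length more than \<open>t\<close>. As no such block has length \<open>k0\<close>,
  the latter ends on one side far enough inside the window, and a gap forms beyond this end; the
  margin \<open>w\<close> on either side leaves the room for it.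
\<close>

lemma gap_exists:
  fixes B G t p n k0 :: int
  defines "w \<equiv> B * L + G"
  assumes B: "0 < B"
    and G: "0 \<le> G" "0 \<le> k0"
    and t: "B * (L + 1 + w) \<le> t"
    and inside: "A \<le> p" "n \<le> Z"
    and not_two: "\<And>k d l. int k \<le> i_max \<Longrightarrow> B < d \<Longrightarrow> d \<le> 2 * B \<Longrightarrow> p \<le> l \<Longrightarrow>
      int k + l + k0 - 1 \<le> n \<Longrightarrow> \<exists>q\<in>{l..l + k0 - 1}. g k q \<notin> {0, d}"
    and "int h \<le> B"
    and "\<And>q. p \<le> q \<Longrightarrow> int i + q \<le> n \<Longrightarrow> g i q \<le> B + int h"
    and "int i + int h * t \<le> i_max"
    and "p + k0 + 2 * (w + 1) + int h * t \<le> n - int i + 1"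
  shows "\<exists>k l. i \<le> k \<and> int k \<le> int i + int h * t \<and> p \<le> l \<and> int k + l + G - 1 \<le> n
    \<and> (\<forall>q. l \<le> q \<and> q \<le> l + G - 1 \<longrightarrow> g k q \<le> B)"
  using assms(9-)
proof (induction h arbitrary: i)
  have w: "0 \<le> w" "G \<le> w" unfolding w_def using B G L_pos by auto
  {
    case 0
    then show ?case using w G by (intro exI[of _ i] exI[of _ p]) auto
  next
    case (Suc h)
    have "1 * (L + 1 + w) \<le> B * (L + 1 + w)" using B w L_pos by (intro mult_right_mono) auto
    then have "L + 1 + w \<le> t" using t by simp
    then have tL: "L \<le> t" "0 \<le> t" using w L_pos by auto
    have ht: "int (Suc h) * t = int h * t + t" "0 \<le> int h * t"
      using tL by (auto simp: algebra_simps)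
    have t_le: "t \<le> int (Suc h) * t" unfolding ht(1) using ht(2) by linarith
    define i' where "i' = i + nat t"
    have i': "int i' = int i + t" unfolding i'_def using tL by simp
    define c where "c = B + int (Suc h)"
    have c: "B < c" "c \<le> 2 * B" using Suc.prems unfolding c_def by auto
    have le_c: "g i q \<le> c" if "p \<le> q" "int i + q \<le> n" for q
      using Suc.prems(2) that unfolding c_def by simp
    show ?case
    proof (cases "\<forall>q. p \<le> q \<and> int i' + q \<le> n \<longrightarrow> g i' q \<le> B + int h")
      case True
      have "\<exists>k l. i' \<le> k \<and> int k \<le> int i' + int h * t \<and> p \<le> l \<and> int k + l + G - 1 \<le> n
          \<and> (\<forall>q. l \<le> q \<and> q \<le> l + G - 1 \<longrightarrow> g k q \<le> B)"
        using True Suc.prems i' ht by (intro Suc.IH) auto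
      then obtain k l where "i' \<le> k" "int k \<le> int i' + int h * t" "p \<le> l" "int k + l + G - 1 \<le> n"
          "\<forall>q. l \<le> q \<and> q \<le> l + G - 1 \<longrightarrow> g k q \<le> B"
        by blast
      then show ?thesis using i' ht tL by (intro exI[of _ k] exI[of _ l]) auto
    next
      case False
      then obtain j where j: "p \<le> j" "int i' + j \<le> n" "B + int h < g i' j" by force
      have low: "g k q \<le> c" if "i \<le> k" "p \<le> q" "int k + q \<le> n" for k q
        using that inside
        by (intro cone_bound[of p "n - int i" i, OF le_c]) auto
      have gj: "g i' j = c"
        using low[of i' j] j i' tL unfolding c_def by auto
      have block: "g i q \<in> {0, c}" if "j \<le> q" "q \<le> j + t" for q
      proof -
        have "(\<forall>q. max j (int i + j - int i) \<le> q \<and> q \<le> min (int i' + j - int i) (j + t)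
            \<longrightarrow> g i q \<in> {0, c}) \<and> (\<exists>q. max j (int i + j - int i) \<le> q
            \<and> q \<le> min (int i' + j - int i) (j + t) \<and> g i q = c)"
          using inside j i' tL by (intro two_valued_above[OF gj, where ?i0.0 = i] low) auto
        then show ?thesis using that i' by auto
      qed
      \<comment> \<open>Columns right (\<open>P\<close>) and left (\<open>Q\<close>) of the block where two-valuedness fails and which keep
        the distance \<open>w\<close> from the edge of the window.\<close>
      define P where "P = {q. j + t < q \<and> int i + q + w \<le> n \<and> g i q \<notin> {0, c}}"
      define Q where "Q = {q. q < j \<and> p + w \<le> q \<and> g i q \<notin> {0, c}}"
      consider (right) "P \<noteq> {}" | (left) "Q \<noteq> {}" | (none) "P = {}" "Q = {}" by blast
      then show ?thesis
      proof cases
        case right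
        have fin: "finite P"
          by (rule finite_subset[of _ "{j + t..n - int i - w}"]) (auto simp: P_def)
        define y where "y = Min P - 1"
        have y: "y + 1 \<in> P" using Min_in[OF fin right] unfolding y_def by simp
        have "g i q \<in> {0, c}" if "j \<le> q" "q \<le> y" for q
        proof (cases "q \<le> j + t")
          case False
          have "q \<notin> P" using Min_le[OF fin, of q] that unfolding y_def by auto
          then show ?thesis using False that y unfolding P_def by auto
        qed (use block that in auto)
        then have "\<exists>k l. i \<le> k \<and> int k \<le> int i + t \<and> j \<le> l
            \<and> int k + l + G - 1 \<le> int i + y + 1 + (B * L + G)
            \<and> (\<forall>q. l \<le> q \<and> q \<le> l + G - 1 \<longrightarrow> g k q \<le> B)"
          using y inside j t unfolding P_def w_def
          by (intro gap_right_of_block[OF c G(1)] le_c) auto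
        then obtain k l where "i \<le> k" "int k \<le> int i + t" "j \<le> l"
            "int k + l + G - 1 \<le> int i + y + 1 + w"
            "\<forall>q. l \<le> q \<and> q \<le> l + G - 1 \<longrightarrow> g k q \<le> B"
          unfolding w_def by blast
        moreover have "int i + y + 1 + w \<le> n" using y unfolding P_def by simp
        ultimately show ?thesis using j t_le by (intro exI[of _ k] exI[of _ l] conjI; linarith?; blast?)
      next
        case left
        have fin: "finite Q"
          by (rule finite_subset[of _ "{p + w..j}"]) (auto simp: Q_def)
        define x where "x = Max Q + 1"
        have x: "x - 1 \<in> Q" using Max_in[OF fin left] unfolding x_def by simp
        have "g i q \<in> {0, c}" if "x \<le> q" "q \<le> j + t" for q
        proof (cases "j \<le> q")
          case False
          have "q \<notin> Q" using Max_ge[OF fin, of q] that unfolding x_def by auto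
          then show ?thesis using False that x unfolding Q_def by auto
        qed (use block that in auto)
        then have "\<exists>k l. i \<le> k \<and> int k \<le> int i + t \<and> x - 1 - (B * L + G) \<le> l
            \<and> int k + l + G - 1 \<le> int i + (j + t)
            \<and> (\<forall>q. l \<le> q \<and> q \<le> l + G - 1 \<longrightarrow> g k q \<le> B)"
          using x inside j t i' unfolding Q_def w_def
          by (intro gap_left_of_block[OF c G(1)] le_c) auto
        then obtain k l where "i \<le> k" "int k \<le> int i + t" "x - 1 - w \<le> l"
            "int k + l + G - 1 \<le> int i + (j + t)"
            "\<forall>q. l \<le> q \<and> q \<le> l + G - 1 \<longrightarrow> g k q \<le> B"
          unfolding w_def by blast
        moreover have "p \<le> x - 1 - w" using x unfolding Q_def by simp
        ultimately show ?thesis using j i' t_le by (intro exI[of _ k] exI[of _ l] conjI; linarith?; blast?)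
      next
        case none
        have rows: "int i \<le> i_max" "p + k0 + 2 * (w + 1) \<le> n - int i + 1"
          using Suc.prems(3,4) ht(2) tL(2) unfolding ht(1) by linarith+
        have "g i q \<in> {0, c}" if "p + w \<le> q" "int i + q + w \<le> n" for q
          using that none block[of q] unfolding P_def Q_def by (cases "q < j"; cases "q \<le> j + t") auto
        moreover have "\<exists>q\<in>{p + w..p + w + k0 - 1}. g i q \<notin> {0, c}"
        proof (rule not_two[OF rows(1) c])
          show "p \<le> p + w" using w by simp
          show "int i + (p + w) + k0 - 1 \<le> n" using rows(2) w by simp
        qed
        ultimately show ?thesis using rows w by force
      qed
    qed
  }
qed

section \<open>Gaps halve the bound\<close>

text \<open>
  The values \<open>2 * B, \<dots>, B + 1\<close> are excluded in turn. If \<open>c\<close> is the current bound and occurs below,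
  then \<open>two_valued_above\<close>, applied between a diagonal and a column through the gap, yields a
  \<open>c\<close> in the gap itself. Each value costs a margin \<open>L\<close> on both ends of the gap, which is
  why gaps have length \<open>2 * B * L\<close>.
\<close>

lemma gap_spreads:
  fixes B :: int
  assumes B: "0 < B"
    and gap: "\<And>q. l \<le> q \<Longrightarrow> q \<le> l + 2 * B * L - 1 \<Longrightarrow> g i0 q \<le> B"
    and region: "\<And>i j. i0 \<le> i \<Longrightarrow> A \<le> j \<Longrightarrow> int i + j \<le> Z \<Longrightarrow> int i0 + l \<le> int i + j \<Longrightarrow>
      g i j \<le> 2 * B"
    and ij: "i0 \<le> i" "A \<le> j" "int i + j \<le> Z" "int i0 + l + B * L \<le> int i + j"
      "j \<le> l + B * L - 1"
  shows "g i j \<le> B"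
proof -
  have "g i j \<le> 2 * B - int h"
    if "int h \<le> B" "i0 \<le> i" "A \<le> j" "int i + j \<le> Z" "int i0 + l + int h * L \<le> int i + j"
      "j \<le> l + 2 * B * L - 1 - int h * L" for h i j
    using that
  proof (induction h arbitrary: i j)
    case 0
    then show ?case using region by simp
  next
    case (Suc h)
    have hS: "int (Suc h) * L = int h * L + L" "0 \<le> int h * L"
      using L_pos by (auto simp: algebra_simps)
    have "int (Suc h) * L \<le> B * L" using Suc.prems L_pos by (intro mult_right_mono) auto
    then have hB: "2 * (int h * L) + 2 * L \<le> 2 * B * L" using hS by simp
    define c where "c = 2 * B - int h"
    have le: "g i j \<le> c"
      unfolding c_def using Suc.prems hS L_pos by (intro Suc.IH) auto
    have "g i j \<noteq> c"
    proof
      assume eq: "g i j = c"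
      define lo hi where "lo = int i0 + l + int h * L" and "hi = l + 2 * B * L - 1 - int h * L"
      have room: "lo + L \<le> int i + j" "j + L \<le> hi" "lo + L \<le> int i0 + hi"
        using Suc.prems hS hB L_pos unfolding lo_def hi_def by linarith+
      have "(\<forall>q. max j (lo - int i0) \<le> q \<and> q \<le> min (int i + j - int i0) hi \<longrightarrow> g i0 q \<in> {0, c})
          \<and> (\<exists>q. max j (lo - int i0) \<le> q \<and> q \<le> min (int i + j - int i0) hi \<and> g i0 q = c)"
      proof (rule two_valued_above[OF eq, where ?i0.0 = i0 and k = i0])
        fix k q
        assume "i0 \<le> k" "k < i" "j \<le> q" "int k + q \<le> int i + j" "lo \<le> int k + q" "q \<le> hi"
        then show "g k q \<le> c"
          using Suc.prems unfolding lo_def hi_def c_def by (intro Suc.IH) auto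
      qed (use Suc.prems room in auto)
      then obtain q where "lo - int i0 \<le> q" "q \<le> hi" "g i0 q = c" by auto
      then show False
        using gap[of q] Suc.prems(1) hS unfolding lo_def hi_def c_def by auto
    qed
    then show ?case using le unfolding c_def by simp
  qed
  from this[of "nat B" i j] show ?thesis using B ij by auto
qed

text \<open>
  The window used for the entry \<open>(i, j)\<close> is cut out by the column \<open>p \<ge> j\<close> and the
  diagonal of \<open>(i, j)\<close>; all of it consists of ancestors of \<open>(i, j)\<close>, hence so does the gap.
  The margin \<open>w\<close> of \<open>gap_exists\<close> is \<open>3 * B * L\<close> for gaps of length \<open>2 * B * L\<close>.
\<close>

lemma halving:
  fixes B p k0 :: int
  defines "t \<equiv> B * (L + 1 + 3 * B * L)"
  assumes B: "0 < B" and k0: "0 \<le> k0"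
    and region: "\<And>i j. i0 \<le> i \<Longrightarrow> A \<le> j \<Longrightarrow> int i + j \<le> Z \<Longrightarrow> int i0 + p \<le> int i + j \<Longrightarrow>
      g i j \<le> 2 * B"
    and not_two: "\<And>k d l. int k \<le> int i0 + B * t \<Longrightarrow> B < d \<Longrightarrow> d \<le> 2 * B \<Longrightarrow> p \<le> l \<Longrightarrow>
      int k + l + k0 - 1 \<le> Z \<Longrightarrow> \<exists>q\<in>{l..l + k0 - 1}. g k q \<notin> {0, d}"
    and ij: "int i0 + B * t \<le> int i" "A \<le> j" "int i + j \<le> Z" "j \<le> p"
    and long: "int i0 + p + k0 + 2 * (3 * B * L + 1) + B * t \<le> int i + j"
  shows "g i j \<le> B"
proof -
  have BL: "0 < B * L" using B L_pos by simp
  have "0 \<le> L + 1 + 3 * B * L" using BL L_pos by simp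
  then have t: "0 \<le> t" "0 \<le> B * t" using B unfolding t_def by auto
  have w: "B * L + 2 * B * L = 3 * B * L" by simp
  have "\<exists>k l. i0 \<le> k \<and> int k \<le> int i0 + int (nat B) * t \<and> p \<le> l \<and> int k + l + 2 * B * L - 1 \<le> int i + j
      \<and> (\<forall>q. l \<le> q \<and> q \<le> l + 2 * B * L - 1 \<longrightarrow> g k q \<le> B)"
  proof (rule gap_exists[where i_max = "int i0 + B * t" and ?k0.0 = k0 and n = "int i + j"])
    show "B * (L + 1 + (B * L + 2 * B * L)) \<le> t" unfolding t_def w by simp
    show "g i0 q \<le> B + int (nat B)" if "p \<le> q" "int i0 + q \<le> int i + j" for q
      using region[of i0 q] that B ij by simp
    show "p + k0 + 2 * (B * L + 2 * B * L + 1) + int (nat B) * t \<le> int i + j - int i0 + 1"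
      unfolding w using long B by simp
  qed (use B k0 BL ij t not_two in auto)
  then obtain k l where kl: "i0 \<le> k" "int k \<le> int i0 + B * t" "p \<le> l"
      "int k + l + 2 * B * L - 1 \<le> int i + j"
      and gap: "\<And>q. l \<le> q \<Longrightarrow> q \<le> l + 2 * B * L - 1 \<Longrightarrow> g k q \<le> B"
    using B by auto
  show ?thesis
    by (rule gap_spreads[OF B gap]) (use kl ij BL in \<open>auto intro!: region\<close>)
qed

end

section \<open>The Gilbreath array\<close>

text \<open>
  The extension of the array to negative columns, where the rule would fail for
  \<open>gilbreath a i (nat j)\<close>.
\<close>

fun int_triangle :: "(int \<Rightarrow> int) \<Rightarrow> nat \<Rightarrow> int \<Rightarrow> int" where
  "int_triangle f 0 j = f j"
| "int_triangle f (Suc i) j = \<bar>int_triangle f i j - int_triangle f i (j + 1)\<bar>"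

lemma int_triangle_eq_gilbreath:
  "int_triangle (\<lambda>j. a (nat j)) i (int j) = gilbreath a i j"
proof (induction i arbitrary: j)
  case (Suc i)
  show ?case using Suc[of j] Suc[of "j + 1"] by (simp add: add.commute)
qed simp

text \<open>
  The left-hand side collects what one halving needs: the number of rows until a gap is
  found, and the margins of the window.
\<close>

lemma halving_time_bound:
  fixes B L :: int
  assumes "1 \<le> B" "1 \<le> L"
  shows "2 * (3 * B * L + 1) + B * (B * (L + 1 + 3 * B * L)) + 1 \<le> 14 * (B ^ 3 * L)"
proof -
  have "B \<le> B ^ 3" "B ^ 2 \<le> B ^ 3" "1 \<le> B ^ 3"
    using power_increasing[of 1 3 B] power_increasing[of 2 3 B] power_increasing[of 0 3 B] assms
    by simp_all
  then have "B * L \<le> B ^ 3 * L" "B ^ 2 * L \<le> B ^ 3 * L" "1 * L \<le> B ^ 3 * L"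
    using assms by (auto intro!: mult_right_mono)
  moreover have "B ^ 2 * 1 \<le> B ^ 2 * L" using assms by (intro mult_left_mono) auto
  moreover have "2 * (3 * B * L + 1) + B * (B * (L + 1 + 3 * B * L)) + 1
      = 6 * (B * L) + B ^ 2 * L + B ^ 2 + 3 * (B ^ 3 * L) + 3"
    by (simp add: algebra_simps power2_eq_square power3_eq_cube)
  ultimately show ?thesis using assms by linarith
qed

theorem theorem1p6:
  fixes M L N N' :: nat
    and R :: "nat \<Rightarrow> nat"
    and a :: "nat \<Rightarrow> int"
  assumes "M \<ge> 1" and "L \<ge> 1"
    and "1 \<le> N'" and "N' \<le> N"
    and "1 < R 0"
    and "\<forall>m\<in>{1..M}. R (m - 1) < R m"
    and "real (R M) < (real N - real N') / 2"
    and "\<forall>m\<in>{1..M}. R m \<ge> 4 * R (m - 1)"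
    and "R 0 \<ge> 100 * L * 8 ^ M"
    and "\<forall>n\<in>{1..N}. a n \<ge> 0"
    and bounded: "\<forall>n\<in>{1..N}. a n \<le> 2 ^ M"
    and no_zero_block:
      "\<not> (\<exists>i j. i + L \<le> N \<and> 1 \<le> j \<and> i + j + L \<le> N + 1 \<and>
            (\<forall>t<L. gilbreath a i (j + t) = 0))"
    and no_two_valued_block:
      "\<not> (\<exists>(m::nat) (d::int) (i::nat) (k::nat) (j::nat).
            1 \<le> m \<and> m \<le> M \<and>
            2 ^ (M - m) < d \<and> d \<le> 2 ^ (M - m + 1) \<and>
            i \<le> 2 * R (m - 1) \<and>
            int k \<ge> int (R m) - 3 * int (R (m - 1)) \<and>
            N' \<le> j \<and> i + j + k \<le> N \<and>
            (\<forall>t<k. gilbreath a i (j + t) \<in> {0, d}))"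
  shows "gilbreath a (N - 1) 1 \<in> {0, 1}"
proof -
  define g where "g = int_triangle (\<lambda>j. a (nat j))"
  have g: "g i j = gilbreath a i (nat j)" if "0 \<le> j" for i j
    using int_triangle_eq_gilbreath[of a i "nat j"] that unfolding g_def by simp
  have row_nonneg: "0 \<le> g i j" if "1 \<le> j" "int i + j \<le> int N" for i j
  proof (cases i)
    case 0
    have "nat j \<in> {1..N}" using that 0 by auto
    then show ?thesis using assms(10) 0 unfolding g_def by simp
  qed (simp add: g_def)
  interpret zero_sparse_triangle g 1 "int N" "int L"
  proof
    fix i and j :: int
    assume ij: "1 \<le> j" "int i + j + int L - 1 \<le> int N"
    then have "i + L \<le> N \<and> 1 \<le> nat j \<and> i + nat j + L \<le> N + 1" by linarith
    then obtain t where t: "t < L" "gilbreath a i (nat j + t) \<noteq> 0" using no_zero_block by blast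
    then have "g i (j + int t) \<noteq> 0" using ij by (simp add: g nat_add_distrib)
    then show "\<exists>q\<in>{j..j + int L - 1}. g i q \<noteq> 0"
      using t by (intro bexI[of _ "j + int t"]) auto
  qed (use row_nonneg assms(2) in \<open>auto simp: g_def\<close>)
  have RM: "2 * R M + N' < N"
  proof -
    have "real (2 * R M + N') < real N" using assms(7) by simp
    then show ?thesis by linarith
  qed
  have R0: "R 0 \<le> R m" if "m \<le> M" for m
    using that
  proof (induction m)
    case (Suc m)
    then show ?case using assms(6)[rule_format, of "Suc m"] by simp
  qed simp
  \<comment> \<open>The bound holds for all columns \<open>j \<ge> 1\<close>, also left of \<open>N'\<close>: only the diagonal is restricted.\<close>
  have main: "g i j \<le> 2 ^ (M - m)"
    if "m \<le> M" "R m \<le> i" "1 \<le> j" "int N' + int (R m) \<le> int i + j" "int i + j \<le> int N" for m i j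
    using that
  proof (induction m arbitrary: i j)
    case 0
    show ?case
    proof (rule cone_bound[where ?i0.0 = 0])
      fix q assume "1 \<le> q" "q \<le> int N"
      then have "nat q \<in> {1..N}" by auto
      then show "g 0 q \<le> 2 ^ (M - 0)" using bounded unfolding g_def by simp
    qed (use 0 in auto)
  next
    case (Suc m)
    define r s where "r = R m" and "s = R (Suc m)"
    define B :: int where "B = 2 ^ (M - Suc m)"
    \<comment> \<open>Row \<open>r\<close> of the window then has \<open>s - 2 * r + 1\<close> entries, so there is a margin of about \<open>r\<close>
      beyond the excluded block length \<open>s - 3 * r\<close>, and \<open>p \<ge> N'\<close>.\<close>
    define p where "p = int i + j - int s + int r"
    have rs: "4 * r \<le> s" using assms(8)[rule_format, of "Suc m"] Suc.prems unfolding r_def s_def by simp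
    have B: "1 \<le> B" "2 * B = 2 ^ (M - m)"
      using Suc.prems unfolding B_def by (auto simp flip: power_Suc simp: Suc_diff_Suc)
    define T where "T = B * (B * (int L + 1 + 3 * B * int L))"
    have "B ^ 3 = 8 ^ (M - Suc m)" unfolding B_def by (simp add: power_mult[symmetric] mult.commute power_mult)
    also have "\<dots> \<le> 8 ^ M" by (intro power_increasing) auto
    finally have "B ^ 3 * int L \<le> 8 ^ M * int L" by (intro mult_right_mono) auto
    moreover have "int (100 * L * 8 ^ M) \<le> int r"
      using assms(9) R0[of m] Suc.prems unfolding r_def by linarith
    then have "100 * (8 ^ M * int L) \<le> int r" by (simp add: mult_ac)
    moreover have "2 * (3 * B * int L + 1) + T + 1 \<le> 14 * (B ^ 3 * int L)"
      unfolding T_def using B assms(2) by (intro halving_time_bound) auto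
    moreover have "0 \<le> B ^ 3 * int L" "0 \<le> 3 * B * int L" using B by auto
    ultimately have "2 * (3 * B * int L + 1) + T + 1 \<le> int r \<and> T \<le> int r"
      by (smt (verit))
    then have time: "2 * (3 * B * int L + 1) + T + 1 \<le> int r" "T \<le> int r" by auto
    have "g i j \<le> B"
    proof (rule halving[where ?i0.0 = r and p = p and ?k0.0 = "int s - 3 * int r + 1"])
      show "g k q \<le> 2 * B"
        if "r \<le> k" "1 \<le> q" "int k + q \<le> int N" "int r + p \<le> int k + q" for k q
        unfolding B using that Suc.prems rs unfolding p_def r_def s_def by (intro Suc.IH) auto
      show "\<exists>q\<in>{l..l + (int s - 3 * int r + 1) - 1}. g k q \<notin> {0, d}"
        if "int k \<le> int r + B * (B * (int L + 1 + 3 * B * int L))" "B < d" "d \<le> 2 * B" "p \<le> l"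
          "int k + l + (int s - 3 * int r + 1) - 1 \<le> int N" for k d l
      proof -
        have l: "int N' \<le> l" using that Suc.prems unfolding p_def r_def s_def by linarith
        define b where "b = s - 3 * r"
        have b: "int b = int s - 3 * int r" using rs unfolding b_def by simp
        have "M - Suc m + 1 = M - m" using Suc.prems by simp
        moreover have "k \<le> 2 * r" "N' \<le> nat l" "k + nat l + b \<le> N"
          using that time[unfolded T_def] l b by auto
        ultimately have "\<exists>t<b. gilbreath a k (nat l + t) \<notin> {0, d}"
          using no_two_valued_block Suc.prems that b B
          unfolding r_def s_def B_def
          by (metis (no_types, lifting) Suc_eq_plus1 diff_Suc_1 le_add2 order_refl)
        then obtain t where t: "t < b" "gilbreath a k (nat l + t) \<notin> {0, d}" by blast
        then have "g k (l + int t) \<notin> {0, d}" using l by (simp add: g nat_add_distrib)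
        then show ?thesis using t b by (intro bexI[of _ "l + int t"]) auto
      qed
    qed (use B rs time[unfolded T_def] Suc.prems in \<open>auto simp: p_def r_def s_def\<close>)
    then show ?case unfolding B_def .
  qed
  have "g (N - 1) 1 \<le> 2 ^ (M - M)" using RM assms(4) by (intro main) auto
  moreover have "0 \<le> g (N - 1) 1" using RM by (intro row_nonneg) auto
  ultimately show ?thesis using g[of 1 "N - 1"] by auto
qed

end
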